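(* Let $(f_\ell)_{\ell\in\mathbb N}$ be an admissible sequence of weight functions (as defined in the context) and let $S\subseteq\mathbb N$ with complement $E=\mathbb N\setminus S$. Let $r\ge 3$ be an integer and assume $1,r,r+1\in S$ and $2,3,\dots,r-1\in E$. Let $n$ be an integer with $$n\ \ge\ \frac{r(r-1)(3r-1)+4}{2}.$$ If $n\not\equiv r-1\pmod r$, then $\Delta_{E,\ell}(n)>0$ for all but finitely many $\ell$. If $n\equiv r-1\pmod r$, then $\Delta_{E,\ell}(n)<0$ for all but finitely many $\ell$.
   Context: $\mathbb N=\{1,2,3,\dots\}$. An admissible sequence of weight functions is a sequence $(f_\ell)_{\ell\in\mathbb N}$ of functions $f_\ell:\mathbb N\to\mathbb N$ with $f_\ell(1)=1$ for all $\ell$ and $f_1\equiv 1$, for which there exist real-valued functions $\Phi,\Psi$ on $\mathbb N$ such that: (1) $n^{\Phi(\ell)}\le f_\ell(n)\le n^{\Psi(\ell)}$ for all $\ell,n\in\mathbb N$; (2) there is a positive number $B$ independent of $\ell$ with $0\le\Psi(\ell)-\Phi(\ell)\le B$ for all $\ell$; (3) $\lim_{\ell\to\infty}\Phi(\ell)=\infty$. For $S\subseteq\mathbb N$ with $1\in S$ and $E=\mathbb N\setminus S$ (the exception set), the numbers $p_{E,\ell}(n)$ are defined by the formal power series identity $\sum_{n=0}^\infty p_{E,\ell}(n)q^n=\prod_{n\in S}(1-q^n)^{-f_\ell(n)}$, and $\Delta_{E,\ell}(n):=p_{E,\ell}(n)^2-p_{E,\ell}(n-1)\,p_{E,\ell}(n+1)$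 for $n\ge1$. The finite set of exceptional $\ell$ may depend on $n$. *)

theory Defs
  imports
    "HOL-Analysis.Analysis"
    "HOL-Computational_Algebra.Formal_Power_Series"
    "HOL-Number_Theory.Cong"
begin

text \<open>
  The paper's natural numbers are \<open>{1, 2, 3, \<dots>}\<close>: sequences and functions on them are
  represented by functions on \<^typ>\<open>nat\<close> whose value at 0 is irrelevant.
\<close>

definition admissible_weights :: "(nat \<Rightarrow> nat \<Rightarrow> nat) \<Rightarrow> bool" where
  "admissible_weights f \<longleftrightarrow>
     (\<forall>l\<ge>1. \<forall>n\<ge>1. f l n \<ge> 1) \<and>
     (\<forall>l\<ge>1. f l 1 = 1) \<and>
     (\<forall>n\<ge>1. f 1 n = 1) \<and>
     (\<exists>\<Phi> \<Psi> :: nat \<Rightarrow> real.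
        (\<forall>l\<ge>1. \<forall>n\<ge>1. real n powr \<Phi> l \<le> real (f l n) \<and> real (f l n) \<le> real n powr \<Psi> l) \<and>
        (\<exists>B>0. \<forall>l\<ge>1. 0 \<le> \<Psi> l - \<Phi> l \<and> \<Psi> l - \<Phi> l \<le> B) \<and>
        filterlim \<Phi> at_top sequentially)"

text \<open>
  The infinite product is the library's \<^const>\<open>prodinf\<close> in the metric (that is, coefficientwise)
  topology on formal power series; indices outside \<open>{1..} - E\<close> contribute the factor 1.
  Lemma \<open>p_factor_has_prod\<close> below shows that it converges for every weight function,
  so that \<^const>\<open>prodinf\<close> is never an unspecified value.
\<close>

definition p_factor :: "nat set \<Rightarrow> (nat \<Rightarrow> nat) \<Rightarrow> nat \<Rightarrow> real fps" where
  "p_factor E w k = (if k \<in> {1..} - E then inverse ((1 - fps_X ^ k) ^ w k) else 1)"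

definition p_gf :: "nat set \<Rightarrow> (nat \<Rightarrow> nat) \<Rightarrow> real fps" where
  "p_gf E w = (\<Prod>k. p_factor E w k)"

definition p_coeff :: "nat set \<Rightarrow> (nat \<Rightarrow> nat) \<Rightarrow> nat \<Rightarrow> real" where
  "p_coeff E w n = fps_nth (p_gf E w) n"

text \<open>Meant for \<open>n \<ge> 1\<close> only, because of the truncated subtraction.\<close>

definition Delta :: "nat set \<Rightarrow> (nat \<Rightarrow> nat) \<Rightarrow> nat \<Rightarrow> real" where
  "Delta E w n = (p_coeff E w n)\<^sup>2 - p_coeff E w (n - 1) * p_coeff E w (n + 1)"

lemma p_factor_0 [simp]: "fps_nth (p_factor E w k) 0 = 1"
  by (auto simp: p_factor_def fps_nth_power_0 power_0_left)

lemma p_factor_eq: "\<exists>Y. p_factor E w k = 1 + fps_X ^ k * Y"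
proof (cases "k \<in> {1..} - E")
  case True
  define b :: "real fps" where "b = 1 - fps_X ^ k"
  have nz: "fps_nth (b ^ w k) 0 \<noteq> 0"
    using True by (auto simp: b_def fps_nth_power_0 power_0_left)
  have "1 - b ^ w k = (1 - b) * (\<Sum>i<w k. b ^ i)"
    by (rule one_diff_power_eq)
  then have "1 - b ^ w k = fps_X ^ k * (\<Sum>i<w k. b ^ i)"
    by (simp add: b_def)
  then have "inverse (b ^ w k) * (1 - b ^ w k)
      = fps_X ^ k * (inverse (b ^ w k) * (\<Sum>i<w k. b ^ i))"
    by (simp only: mult.left_commute)
  moreover have "inverse (b ^ w k) * (1 - b ^ w k) = inverse (b ^ w k) - 1"
    by (simp only: right_diff_distrib mult_1_right inverse_mult_eq_1[OF nz])
  ultimately have "inverse (b ^ w k) = 1 + fps_X ^ k * (inverse (b ^ w k) * (\<Sum>i<w k. b ^ i))"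
    by (metis add_diff_cancel_left' add_diff_eq)
  then show ?thesis
    using True unfolding p_factor_def b_def by auto
next
  case False
  then have "p_factor E w k = 1 + fps_X ^ k * 0"
    by (simp only: p_factor_def if_False mult_zero_right add_0_right)
  then show ?thesis ..
qed

lemma p_partial_prod_nth:
  assumes "n \<le> N"
  shows "fps_nth (\<Prod>k\<le>N. p_factor E w k) n = fps_nth (\<Prod>k\<le>n. p_factor E w k) n"
  using assms
proof (induction N rule: dec_induct)
  case (step N)
  obtain Y where Y: "p_factor E w (Suc N) = 1 + fps_X ^ Suc N * Y"
    using p_factor_eq by blast
  have "(\<Prod>k\<le>Suc N. p_factor E w k)
      = (\<Prod>k\<le>N. p_factor E w k) + fps_X ^ Suc N * (Y * (\<Prod>k\<le>N. p_factor E w k))"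
    unfolding prod.atMost_Suc Y by (simp add: algebra_simps del: power_Suc)
  then have "fps_nth (\<Prod>k\<le>Suc N. p_factor E w k) n = fps_nth (\<Prod>k\<le>N. p_factor E w k) n"
    using step.hyps by (simp add: fps_X_power_mult_nth del: power_Suc prod.atMost_Suc)
  then show ?case
    using step.IH by simp
qed simp

lemma p_factor_has_prod:
  "p_factor E w has_prod Abs_fps (\<lambda>n. fps_nth (\<Prod>k\<le>n. p_factor E w k) n)"
    (is "_ has_prod ?G")
proof -
  have "(\<lambda>N. \<Prod>k\<le>N. p_factor E w k) \<longlonglongrightarrow> ?G"
  proof (rule tendsto_fpsI)
    fix n
    show "\<forall>\<^sub>F N in sequentially. fps_nth (\<Prod>k\<le>N. p_factor E w k) n = fps_nth ?G n"
      using eventually_ge_at_top[of n] by eventually_elim (unfold fps_nth_Abs_fps, rule p_partial_prod_nth)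
  qed
  moreover have "fps_nth ?G 0 = 1"
    by simp
  then have "?G \<noteq> 0"
    by (metis fps_zero_nth zero_neq_one)
  ultimately show ?thesis
    by (simp add: has_prod_def raw_has_prod_def)
qed

lemma p_coeff_eq: "p_coeff E w n = fps_nth (\<Prod>k\<le>n. p_factor E w k) n"
  unfolding p_coeff_def p_gf_def has_prod_unique[OF p_factor_has_prod, symmetric] by simp

end

theory Submission
  imports Defs
begin

text \<open>
  The number \<open>p_coeff E w n\<close> counts coloured partitions of \<open>n\<close>: a partition with multiplicities
  \<open>m\<^sub>k\<close> contributes \<open>\<Prod>k. (w k + m\<^sub>k - 1) choose m\<^sub>k\<close>, which for \<open>w = f l\<close> is about
  \<open>\<Prod>k. f l k ^ m\<^sub>k / m\<^sub>k!\<close>. Since \<open>f l k\<close> lies between two powers of \<open>k\<close> whose exponents tend to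
  infinity at bounded distance, the partition with the largest product of parts dominates, provided
  it is unique. An exchange argument shows that for large \<open>n = a r + b\<close> with \<open>b < r\<close> this partition
  consists of \<open>a - b\<close> parts \<open>r\<close> and \<open>b\<close> parts \<open>r + 1\<close>. Comparing the dominant terms of
  \<open>p(n)\<^sup>2\<close> and \<open>p(n - 1) p(n + 1)\<close>, everything is decided by \<open>(r + 1) ^ r < r ^ (r + 1)\<close> if \<open>b = 0\<close> or
  \<open>b = r - 1\<close>. For the other \<open>b\<close> the dominant monomials coincide and the factors \<open>1 / m\<^sub>k!\<close> decide,
  by log-convexity of the factorial.
\<close>

section \<open>Coloured partitions as coefficients of the product\<close>

text \<open>Stars and bars for each part size: the \<open>count M k\<close> copies of k are spread
  over \<open>w k\<close> colours. On \<open>set_mset M\<close> the count is positive, so the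
  subtraction never truncates.\<close>

definition colourings :: "(nat \<Rightarrow> nat) \<Rightarrow> nat multiset \<Rightarrow> nat" where
  "colourings w M = (\<Prod>k\<in>set_mset M. (w k + count M k - 1) choose count M k)"

definition partitions :: "nat set \<Rightarrow> nat \<Rightarrow> nat multiset set" where
  "partitions A n = {M. set_mset M \<subseteq> A \<and> sum_mset M = n}"

lemma colourings_superset:
  assumes "finite A" "set_mset M \<subseteq> A"
  shows "colourings w M = (\<Prod>k\<in>A. (w k + count M k - 1) choose count M k)"
  unfolding colourings_def
  by (rule prod.mono_neutral_left) (use assms in \<open>auto simp: not_in_iff\<close>)

lemma part_le_sum_mset:
  fixes M :: "nat multiset"
  shows "k \<in># M \<Longrightarrow> k \<le> sum_mset M"
  by (auto dest: multi_member_split)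

text \<open>Positive parts force at most n of them, each at most n.\<close>

lemma finite_partitions:
  assumes "0 \<notin> A"
  shows "finite (partitions A n)"
proof -
  have "partitions A n \<subseteq> (\<Union>m\<le>n. multisets_of_size {..n} m)"
  proof
    fix M assume M: "M \<in> partitions A n"
    have pos: "\<forall>k\<in>#M. k \<ge> 1"
      using M assms by (auto simp: partitions_def Suc_le_eq intro!: Nat.gr0I)
    then have "size M \<le> sum_mset M"
      by (induction M) auto
    then show "M \<in> (\<Union>m\<le>n. multisets_of_size {..n} m)"
      using M part_le_sum_mset[of _ M] by (auto simp: partitions_def multisets_of_size_def)
  qed
  then show ?thesis
    by (rule finite_subset) auto
qed

text \<open>By Pascal's rule, multiplying the claimed series for w + 1 by 1 - X^k returns the one
  for w, and the series for w = 0 is 1.\<close>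

lemma inverse_one_minus_X_power_nth:
  fixes w :: nat
  assumes "k \<ge> 1"
  shows "fps_nth (inverse ((1 - fps_X ^ k :: real fps) ^ w)) i =
    (if k dvd i then of_nat ((w + i div k - 1) choose (i div k)) else 0)"
proof -
  define G :: "nat \<Rightarrow> real fps" where
    "G w = Abs_fps (\<lambda>i. if k dvd i then of_nat ((w + i div k - 1) choose (i div k)) else 0)" for w
  \<comment> \<open>Truncated subtraction gives 0 choose 0 = 1 at i = 0, while (m - 1) choose m = 0
    for m >= 1.\<close>
  have G0: "G 0 = 1"
    using assms by (auto simp: G_def fps_eq_iff elim!: dvdE intro!: binomial_eq_0)
  have step: "(1 - fps_X ^ k) * G (Suc w) = G w" for w
  proof (rule fps_ext)
    fix i
    show "fps_nth ((1 - fps_X ^ k) * G (Suc w)) i = fps_nth (G w) i"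
    proof (cases "k dvd i")
      case False
      then have "i \<ge> k \<Longrightarrow> \<not> k dvd (i - k)"
        using dvd_minus_self by auto
      then show ?thesis
        using False by (auto simp: algebra_simps G_def fps_X_power_mult_nth)
    next
      case True
      then obtain m where m: "i = k * m" ..
      show ?thesis
      proof (cases m)
        case 0
        then show ?thesis
          using m assms by (simp add: algebra_simps G_def fps_X_power_mult_nth)
      next
        case (Suc j)
        have "i - k = k * j"
          using m Suc by simp
        then show ?thesis
          using m Suc assms by (simp add: algebra_simps G_def fps_X_power_mult_nth)
      qed
    qed
  qed
  have "(1 - fps_X ^ k) ^ w * G w = 1" for w
  proof (induction w)
    case (Suc w)
    have "(1 - fps_X ^ k) ^ Suc w * G (Suc w) = (1 - fps_X ^ k) ^ w * ((1 - fps_X ^ k) * G (Suc w))"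
      by (simp only: power_Suc2 mult.assoc)
    then show ?case
      using Suc step by simp
  qed (simp add: G0)
  then have "inverse ((1 - fps_X ^ k) ^ w) = G w"
    by (rule fps_inverse_unique)
  then show ?thesis
    by (simp add: G_def)
qed

text \<open>Induction over the part sizes: the coefficient of X^i in a new factor counts the
  colourings of i div k parts equal to k.\<close>

lemma prod_p_factor_nth:
  assumes "finite A"
  shows "fps_nth (\<Prod>k\<in>A. p_factor E w k) n =
    (\<Sum>M\<in>partitions (A \<inter> ({1..} - E)) n. real (colourings w M))"
  using assms
proof (induction A arbitrary: n rule: finite_induct)
  case empty
  have "partitions {} n = (if n = 0 then {{#}} else {})"
    by (auto simp: partitions_def)
  then show ?case
    by (auto simp: colourings_def)
next
  case (insert k A)
  show ?case
  proof (cases "k \<in> {1..} - E")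
    case False
    then have "p_factor E w k = 1" "insert k A \<inter> ({1..} - E) = A \<inter> ({1..} - E)"
      by (auto simp: p_factor_def)
    then show ?thesis
      using insert by simp
  next
    case True
    define B where "B = A \<inter> ({1..} - E)"
    define c where "c m = real ((w k + m - 1) choose m)" for m
    define I where "I = {i. i \<le> n \<and> k dvd i}"
    have k: "k \<ge> 1" and kB: "k \<notin> B" and B: "finite B" "0 \<notin> B"
      using True insert.hyps by (auto simp: B_def)
    have ins: "insert k A \<inter> ({1..} - E) = insert k B"
      using True by (auto simp: B_def)
    have add: "colourings w (M + replicate_mset m k) = ((w k + m - 1) choose m) * colourings w M"
      if "set_mset M \<subseteq> B" for M m
    proof -
      have "count M k = 0"
        using that kB by (auto simp: not_in_iff[symmetric])
      moreover have "(\<Prod>j\<in>B. (w j + count (M + replicate_mset m k) j - 1)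
            choose count (M + replicate_mset m k) j) = colourings w M"
        unfolding colourings_superset[OF B(1) that] using kB by (intro prod.cong) auto
      ultimately show ?thesis
        using that kB B(1) by (subst colourings_superset[of "insert k B"]) auto
    qed
    have pf: "fps_nth (p_factor E w k) i = (if k dvd i then c (i div k) else 0)" for i
      using True k by (simp only: p_factor_def if_True inverse_one_minus_X_power_nth c_def)
    have "fps_nth (\<Prod>k\<in>insert k A. p_factor E w k) n =
        (\<Sum>i=0..n. (if k dvd i then c (i div k) else 0) *
          (\<Sum>M\<in>partitions B (n - i). real (colourings w M)))"
      using insert by (simp add: fps_mult_nth pf B_def)
    also have "\<dots> = (\<Sum>i\<in>I. c (i div k) * (\<Sum>M\<in>partitions B (n - i). real (colourings w M)))"
      by (rule sum.mono_neutral_cong_right) (auto simp: I_def)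
    also have "\<dots> = (\<Sum>(i, M)\<in>Sigma I (\<lambda>i. partitions B (n - i)). c (i div k) * real (colourings w M))"
      unfolding sum_distrib_left by (rule sum.Sigma) (use B in \<open>auto simp: I_def finite_partitions\<close>)
    \<comment> \<open>A partition with parts in \<open>insert k B\<close> splits uniquely into its
      copies of k, of total i, and a partition of n - i with parts in B.\<close>
    also have "\<dots> = (\<Sum>M\<in>partitions (insert k B) n. real (colourings w M))"
    proof (rule sum.reindex_bij_witness[where
          i = "\<lambda>M. (k * count M k, filter_mset (\<lambda>j. j \<noteq> k) M)" and
          j = "\<lambda>(i, M). M + replicate_mset (i div k) k"])
      fix a assume "a \<in> Sigma I (\<lambda>i. partitions B (n - i))"
      then obtain i M where a: "a = (i, M)" "i \<in> I" "M \<in> partitions B (n - i)"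
        by auto
      then have M: "set_mset M \<subseteq> B" "sum_mset M = n - i" "i \<le> n" "k dvd i"
        by (auto simp: partitions_def I_def)
      have 0: "count M k = 0"
        using M kB by (auto simp: not_in_iff[symmetric])
      have filt: "filter_mset (\<lambda>j. j \<noteq> k) (M + replicate_mset (i div k) k) = M"
        by (rule multiset_eqI) (auto simp: 0)
      show "(\<lambda>M. (k * count M k, filter_mset (\<lambda>j. j \<noteq> k) M))
          ((\<lambda>(i, M). M + replicate_mset (i div k) k) a) = a"
        unfolding a prod.case filt using M 0 by simp
      show "(\<lambda>(i, M). M + replicate_mset (i div k) k) a \<in> partitions (insert k B) n"
        using M k by (auto simp: a partitions_def)
      show "real (colourings w ((\<lambda>(i, M). M + replicate_mset (i div k) k) a)) =
          (case a of (i, M) \<Rightarrow> c (i div k) * real (colourings w M))"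
        by (simp add: a add[OF M(1)] c_def)
    next
      fix M assume M: "M \<in> partitions (insert k B) n"
      have eq: "M = filter_mset (\<lambda>j. j \<noteq> k) M + replicate_mset (count M k) k"
        using multiset_partition[of M "\<lambda>j. j = k"] by (simp add: filter_eq_replicate_mset add.commute)
      then show "(\<lambda>(i, M). M + replicate_mset (i div k) k)
          ((\<lambda>M. (k * count M k, filter_mset (\<lambda>j. j \<noteq> k) M)) M) = M"
        using k by simp
      have "sum_mset M = sum_mset (filter_mset (\<lambda>j. j \<noteq> k) M) + k * count M k"
        by (subst eq) simp
      then show "(\<lambda>M. (k * count M k, filter_mset (\<lambda>j. j \<noteq> k) M)) M \<in> Sigma I (\<lambda>i. partitions B (n - i))"
        using M by (auto simp: I_def partitions_def)
    qed
    finally show ?thesis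
      unfolding ins .
  qed
qed

lemma p_coeff_eq_sum_partitions:
  "p_coeff E w n = (\<Sum>M\<in>partitions ({1..} - E) n. real (colourings w M))"
proof -
  have "partitions ({..n} \<inter> ({1..} - E)) n = partitions ({1..} - E) n"
    using part_le_sum_mset by (auto simp: partitions_def)
  then show ?thesis
    by (simp add: p_coeff_eq prod_p_factor_nth)
qed

section \<open>Multichoose numbers against powers\<close>

lemma multichoose_Suc:
  fixes x :: nat
  assumes "x \<ge> 1"
  shows "real ((x + Suc m - 1) choose Suc m) = real ((x + m - 1) choose m) * real (x + m) / real (Suc m)"
proof -
  have "Suc m * ((x + m) choose Suc m) = (x + m) * ((x + m - 1) choose m)"
    using times_binomial_minus1_eq[of "Suc m" "x + m"] by simp
  then have "real (Suc m) * real ((x + m) choose Suc m) = real (x + m) * real ((x + m - 1) choose m)"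
    by (metis of_nat_mult)
  then show ?thesis
    by (simp add: field_simps)
qed

text \<open>Raising m by one multiplies the left side by (x + m) / (m + 1), which is at most x
  because x >= 1.\<close>

lemma multichoose_le_power:
  fixes x :: nat
  assumes "x \<ge> 1"
  shows "(x + m - 1) choose m \<le> x ^ m"
proof (induction m)
  case (Suc m)
  have "Suc m * ((x + m) choose Suc m) = (x + m) * ((x + m - 1) choose m)"
    using times_binomial_minus1_eq[of "Suc m" "x + m"] by simp
  also have "\<dots> \<le> (Suc m * x) * x ^ m"
    using Suc assms by (intro mult_mono) auto
  finally have "Suc m * ((x + m) choose Suc m) \<le> Suc m * (x * x ^ m)"
    by (simp only: mult.assoc)
  then have "(x + m) choose Suc m \<le> x * x ^ m"
    by (simp only: Suc_mult_le_cancel1)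
  then show ?case
    by simp
qed simp

text \<open>By the recurrence, raising m by one multiplies the quotient by (1 + m / g l) / (m + 1),
  which tends to 1 / (m + 1).\<close>

lemma multichoose_over_power_tendsto:
  fixes g :: "nat \<Rightarrow> nat"
  assumes g: "filterlim g at_top F"
  shows "((\<lambda>l. real ((g l + m - 1) choose m) / real (g l) ^ m) \<longlongrightarrow> 1 / fact m) F"
proof (induction m)
  case (Suc m)
  have g': "filterlim (\<lambda>l. real (g l)) at_top F"
    using filterlim_compose[OF filterlim_real_sequentially g] .
  have "((\<lambda>l. 1 + real m / real (g l)) \<longlongrightarrow> 1 + 0) F"
    by (intro tendsto_intros real_tendsto_divide_at_top[OF tendsto_const g'])
  then have lim: "((\<lambda>l. real ((g l + m - 1) choose m) / real (g l) ^ m *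
      (1 + real m / real (g l)) / real (Suc m)) \<longlongrightarrow> 1 / fact m * (1 + 0) / real (Suc m)) F"
    by (intro tendsto_divide tendsto_mult Suc tendsto_const) auto
  have val: "1 / fact m * (1 + 0) / real (Suc m) = (1 / fact (Suc m) :: real)"
    by (simp add: field_simps)
  have "\<forall>\<^sub>F l in F. g l \<ge> 1"
    using g by (auto simp: filterlim_at_top)
  then have eq: "\<forall>\<^sub>F l in F. real ((g l + m - 1) choose m) / real (g l) ^ m *
      (1 + real m / real (g l)) / real (Suc m) = real ((g l + Suc m - 1) choose Suc m) / real (g l) ^ Suc m"
  proof eventually_elim
    case (elim l)
    then have "1 + real m / real (g l) = real (g l + m) / real (g l)"
      by (simp add: add_divide_distrib)
    then show ?case
      by (simp only: multichoose_Suc[OF elim] power_Suc2 times_divide_times_eq divide_divide_eq_left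
          times_divide_eq_left times_divide_eq_right mult_ac)
  qed
  show ?case
    using Lim_transform_eventually[OF lim eq] unfolding val .
qed simp

section \<open>The partition with the largest product of parts\<close>

text \<open>A discrete form of the decrease of x^(1/x) beyond e: for k >= r, passing to k + 1
  multiplies the left side by (1 + 1/k)^r <= e and the right side by r >= 3 > e.\<close>

lemma power_swap_less:
  fixes r k :: nat
  assumes "3 \<le> r" "r < k"
  shows "k ^ r < r ^ k"
proof -
  have step: "(k + 1) ^ r < r * k ^ r" if "r \<le> k" for k
  proof -
    have "(1 + 1 / real k) ^ r \<le> exp (1 / real k) ^ r"
      by (intro power_mono) auto
    also have "\<dots> = exp (real r / real k)"
      by (simp flip: exp_of_nat_mult)
    also have "\<dots> \<le> exp 1"
      using that assms by simp
    also have "\<dots> < real r"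
      using e_less_272 assms by simp
    finally have "(1 + 1 / real k) ^ r * real k ^ r < real r * real k ^ r"
      using that assms by (intro mult_strict_right_mono) auto
    moreover have "(1 + 1 / real k) * real k = real (k + 1)"
      using that assms by (simp add: field_simps)
    ultimately have "real (k + 1) ^ r < real r * real k ^ r"
      by (metis power_mult_distrib)
    then show ?thesis
      by (metis of_nat_less_iff of_nat_mult of_nat_power)
  qed
  have "Suc r \<le> k"
    using assms by simp
  then show ?thesis
  proof (induction k rule: dec_induct)
    case base
    show ?case
      using step[of r] by simp
  next
    case (step k)
    have "Suc k ^ r < r * k ^ r"
      using \<open>\<And>k. r \<le> k \<Longrightarrow> (k + 1) ^ r < r * k ^ r\<close>[of k] step.hyps by simp
    also have "\<dots> < r * r ^ k"
      using step.IH assms by simp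
    finally show ?case
      by simp
  qed
qed

text \<open>A partition of \<open>n\<close> only if \<open>n mod r \<le> n div r\<close>, because of the truncated subtraction.\<close>

definition balanced_partition :: "nat \<Rightarrow> nat \<Rightarrow> nat multiset" where
  "balanced_partition r n =
    replicate_mset (n div r - n mod r) r + replicate_mset (n mod r) (r + 1)"

lemma balanced_partition_eq:
  assumes "b < r"
  shows "balanced_partition r (a * r + b) = replicate_mset (a - b) r + replicate_mset b (r + 1)"
  using assms by (simp add: balanced_partition_def)

text \<open>The exchange move. The untouched parts have a positive product since 0 is not in A, so
  the gain from X to Y survives.\<close>

lemma replace_parts:
  fixes M :: "nat multiset"
  assumes "M \<in> partitions A n" "0 \<notin> A" "X \<subseteq># M" "set_mset Y \<subseteq> A"
    and "sum_mset Y = sum_mset X" "prod_mset X < prod_mset Y"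
  shows "\<exists>M'\<in>partitions A n. prod_mset M < prod_mset M'"
proof -
  obtain Z where Z: "M = X + Z"
    using assms(3) by (auto simp: subset_mset.le_iff_add)
  have "0 \<notin># Z"
    using assms(1,2) Z by (auto simp: partitions_def)
  then have "prod_mset Z > 0"
    by (metis gr0I prod_mset_zero_iff)
  then show ?thesis
    using assms by (intro bexI[of _ "Y + Z"]) (auto simp: partitions_def Z)
qed

text \<open>Serves to bound partitions with parts strictly between r and 2 * r. From r to r + 1 the
  interval loses r + 1 and gains 2 * r and 2 * r + 1.\<close>

lemma sum_parts_above:
  "2 * (\<Sum>k\<in>{r<..<2*r}. k) = 3 * r * (r - 1)" for r :: nat
proof (induction r)
  case (Suc r)
  show ?case
  proof (cases "r = 0")
    case False
    \<comment> \<open>Both sides are \<open>{r+1..2*r+1}\<close>; at r = 0 the left side would also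
      contain 0.\<close>
    have "{r<..<2*r} \<union> {2*r, 2*r+1} = insert (Suc r) {Suc r<..<2 * Suc r}"
      using False by auto
    then have "(\<Sum>k\<in>{r<..<2*r} \<union> {2*r, 2*r+1}. k) = Suc r + (\<Sum>k\<in>{Suc r<..<2 * Suc r}. k)"
      by simp
    moreover have "(\<Sum>k\<in>{r<..<2*r} \<union> {2*r, 2*r+1}. k) = (\<Sum>k\<in>{r<..<2*r}. k) + (4 * r + 1)"
      by (subst sum.union_disjoint) auto
    ultimately have "2 * (Suc r + (\<Sum>k\<in>{Suc r<..<2 * Suc r}. k)) = 3 * r * (r - 1) + 2 * (4 * r + 1)"
      using Suc by simp
    moreover obtain q where "r = Suc q"
      using False by (cases r) auto
    ultimately show ?thesis
      by (simp add: algebra_simps)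
  qed (simp add: greaterThanLessThan_def)
qed simp

lemma sum_mset_conv_count:
  "sum_mset M = (\<Sum>k\<in>set_mset M. count M k * k)" for M :: "nat multiset"
proof (induction M)
  case (add x M)
  have "(\<Sum>k\<in>set_mset (add_mset x M). count (add_mset x M) k * k)
      = (\<Sum>k\<in>insert x (set_mset M). (if k = x then x else 0) + count M k * k)"
    by (intro sum.cong) auto
  also have "\<dots> = x + (\<Sum>k\<in>insert x (set_mset M). count M k * k)"
    by (simp add: sum.distrib)
  also have "(\<Sum>k\<in>insert x (set_mset M). count M k * k) = (\<Sum>k\<in>set_mset M. count M k * k)"
    by (rule sum.mono_neutral_right) (auto simp: not_in_iff)
  finally show ?case
    using add by simp
qed simp

text \<open>
  If none of the exchanges applies and \<open>r\<close> is not a part, then all parts lie strictly between \<open>r\<close>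
  and \<open>2 * r\<close> and have multiplicity less than \<open>r\<close>; the lower bound on \<open>n\<close> excludes this.
\<close>

lemma improve_partition:
  fixes r n :: nat
  defines "A \<equiv> insert 1 {r..}"
  assumes r: "r \<ge> 3" and n: "2 * n > 3 * r * (r - 1) * (r - 1)"
    and M: "M \<in> partitions A n" "M \<noteq> balanced_partition r n"
  shows "\<exists>M'\<in>partitions A n. prod_mset M < prod_mset M'"
proof -
  note replace = replace_parts[OF M(1)]
  have A: "0 \<notin> A" and MA: "set_mset M \<subseteq> A" "sum_mset M = n"
    using r M by (auto simp: A_def partitions_def)
  have "3 * r * (r - 1) * (r - 1) \<ge> 3 * r * 1 * 1"
    using r by (intro mult_mono) auto
  \<comment> \<open>Leaves enough ones to form a part r in the case \<open>ones\<close>.\<close>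
  then have "n > r"
    using n r by linarith
  \<comment> \<open>The first five cases allow an exchange: r ones become r; 1, k become k + 1; k
    becomes k - r, r; r copies of k become k copies of r; r, k become r + 1, k - 1. Case
    \<open>small\<close> is impossible by size, and \<open>balanced\<close> leaves only the excluded
    partition.\<close>
  consider (ones) "set_mset M \<subseteq> {1}" | (one) k where "1 \<in># M" "k \<in># M" "k \<ge> r"
    | (large) k where "k \<in># M" "k \<ge> 2 * r"
    | (multiple) k where "k > r" "count M k \<ge> r"
    | (gap) k where "r \<in># M" "k \<in># M" "k \<ge> r + 2"
    | (small) "set_mset M \<subseteq> {r<..<2*r}" "\<forall>k>r. count M k < r"
    | (balanced) "set_mset M \<subseteq> {r, r + 1}" "count M (r + 1) < r"
  proof (cases "1 \<in># M")
    case True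
    then show ?thesis
      using that(1,2) MA by (auto simp: A_def)
  next
    case 1: False
    show ?thesis
    proof (cases "\<exists>k\<in>#M. k \<ge> 2 * r")
      case 2: False
      show ?thesis
      proof (cases "\<exists>k>r. count M k \<ge> r")
        case 3: False
        have *: "k \<ge> r \<and> k < 2 * r" if "k \<in># M" for k
          using that 1 2 MA by (auto simp: A_def)
        show ?thesis
        proof (cases "r \<in># M")
          case True
          have "set_mset M \<subseteq> {r, r + 1}" if "\<not> (\<exists>k\<in>#M. k \<ge> r + 2)"
          proof
            fix k assume "k \<in># M"
            then have "k \<ge> r" "\<not> k \<ge> r + 2"
              using * that by auto
            then show "k \<in> {r, r + 1}"
              by auto
          qed
          moreover have "count M (r + 1) < r"
            using 3 by (meson less_add_one not_less)
          ultimately show ?thesis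
            using True that(5,7) by blast
        next
          case False
          have "set_mset M \<subseteq> {r<..<2*r}"
          proof
            fix k assume k: "k \<in># M"
            then have "k \<noteq> r"
              using False by auto
            then show "k \<in> {r<..<2*r}"
              using *[OF k] by simp
          qed
          moreover have "\<forall>k>r. count M k < r"
            using 3 by (meson not_less)
          ultimately show ?thesis
            by (rule that(6))
        qed
      qed (use that(4) in blast)
    qed (use that(3) in blast)
  qed
  then show ?thesis
  proof cases
    case ones
    then have "M = replicate_mset (size M) 1"
      by (metis set_mset_subset_singletonD size_replicate_mset)
    then have "M = replicate_mset n 1"
      using MA(2) by (metis mult.right_neutral sum_mset_replicate_mset of_nat_id)
    then have "replicate_mset r 1 \<subseteq># M"
      using \<open>n > r\<close> by (simp add: mset_subset_eq_count subseteq_mset_def)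
    then show ?thesis
      by (rule replace[OF A, of _ "{#r#}"]) (use r in \<open>auto simp: A_def\<close>)
  next
    case one
    then have "{#1, k#} \<subseteq># M"
      using r by (auto simp: insert_subset_eq_iff in_diff_count)
    then show ?thesis
      by (rule replace[OF A, of _ "{#k + 1#}"]) (use one in \<open>auto simp: A_def\<close>)
  next
    case large
    \<comment> \<open>With k = 2 * r + q, the right side is r * (r + q) >= 3 * (r + q) > 2 * r +
      q.\<close>
    have "k < (k - r) * r"
    proof -
      obtain q where "k = 2 * r + q"
        using large(2) le_Suc_ex by blast
      moreover have "3 * (r + q) \<le> r * (r + q)"
        using r by (intro mult_right_mono) auto
      ultimately show ?thesis
        using r by (simp add: algebra_simps)
    qed
    then show ?thesis
      by (intro replace[OF A, of "{#k#}" "{#k - r, r#}"]) (use large in \<open>auto simp: A_def\<close>)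
  next
    case multiple
    then have "replicate_mset r k \<subseteq># M"
      by (simp add: count_le_replicate_mset_subset_eq)
    then show ?thesis
      by (rule replace[OF A, of _ "replicate_mset k r"])
        (use multiple power_swap_less[OF r, of k] in \<open>auto simp: A_def\<close>)
  next
    case gap
    then have "{#r, k#} \<subseteq># M"
      by (auto simp: insert_subset_eq_iff in_diff_count)
    moreover obtain q where "k = r + 2 + q"
      using gap(3) le_Suc_ex by blast
    \<comment> \<open>The gain is k - r - 1 = q + 1.\<close>
    then have "r * k < (r + 1) * (k - 1)"
      by (simp add: algebra_simps)
    ultimately show ?thesis
      by (intro replace[OF A, of "{#r, k#}" "{#r + 1, k - 1#}"]) (use gap in \<open>auto simp: A_def\<close>)
  next
    case small
    have "n = (\<Sum>k\<in>set_mset M. count M k * k)"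
      using MA sum_mset_conv_count by simp
    also have "\<dots> \<le> (\<Sum>k\<in>set_mset M. (r - 1) * k)"
      using small by (intro sum_mono mult_right_mono) (auto simp: subset_iff Suc_le_eq le_diff_conv less_Suc_eq_le[symmetric])
    also have "\<dots> \<le> (\<Sum>k\<in>{r<..<2*r}. (r - 1) * k)"
      using small by (intro sum_mono2) auto
    also have "\<dots> = (r - 1) * (\<Sum>k\<in>{r<..<2*r}. k)"
      by (rule sum_distrib_left[symmetric])
    finally have "2 * n \<le> (r - 1) * (2 * (\<Sum>k\<in>{r<..<2*r}. k))"
      by linarith
    also have "\<dots> = 3 * r * (r - 1) * (r - 1)"
      by (subst sum_parts_above) (simp only: mult_ac)
    finally show ?thesis
      using n by linarith
  next
    case balanced
    define i j where "i = count M r" and "j = count M (r + 1)"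
    have eq: "M = replicate_mset i r + replicate_mset j (r + 1)"
    proof (rule multiset_eqI)
      fix k
      show "count M k = count (replicate_mset i r + replicate_mset j (r + 1)) k"
        using balanced(1) by (cases "k \<in># M") (auto simp: i_def j_def not_in_iff)
    qed
    \<comment> \<open>As j < r, this is division with remainder: j = n mod r and i + j = n div
      r.\<close>
    then have "n = (i + j) * r + j"
      using MA(2) by (simp add: algebra_simps)
    moreover have "j < r"
      using balanced by (simp add: j_def)
    ultimately have "balanced_partition r n = M"
      using balanced_partition_eq[of j r "i + j"] eq by simp
    then show ?thesis
      using M(2) by simp
  qed
qed

text \<open>The size bound gives n >= r * r, so the quotient is at least r and exceeds the
  remainder; the subtraction in \<open>balanced_partition\<close> is then genuine.\<close>

lemma balanced_partition_in_partitions: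
  assumes "r \<ge> 3" "2 * n > 3 * r * (r - 1) * (r - 1)" "r \<in> S" "r + 1 \<in> S"
  shows "n mod r < n div r" "balanced_partition r n \<in> partitions S n"
proof -
  have "3 * r * (r - 1) * (r - 1) \<ge> 3 * r * (r - 1) * 2"
    using assms by (intro mult_left_mono) auto
  then have "n \<ge> r * r"
    using assms(1,2) by (cases r) (auto simp: algebra_simps)
  then have "n div r \<ge> r"
    using assms(1) by (simp add: less_eq_div_iff_mult_less_eq)
  then show *: "n mod r < n div r"
    using assms(1) by (intro order_less_le_trans[OF mod_less_divisor]) auto
  obtain d where d: "n div r = n mod r + d"
    using * le_Suc_ex less_imp_le by blast
  have "n = n div r * r + n mod r"
    by simp
  then have "(n div r - n mod r) * r + n mod r * (r + 1) = n"
    unfolding d by (simp add: algebra_simps)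
  then show "balanced_partition r n \<in> partitions S n"
    using assms by (auto simp: balanced_partition_def partitions_def simp del: mult_Suc_right split: if_splits)
qed

text \<open>A maximiser exists by finiteness and cannot be improved, so it is the balanced
  partition. Any other M can be improved, so it lies strictly below the maximum.\<close>

lemma balanced_partition_maximal:
  assumes "r \<ge> 3" "2 * n > 3 * r * (r - 1) * (r - 1)"
    and "M \<in> partitions (insert 1 {r..}) n" "M \<noteq> balanced_partition r n"
  shows "prod_mset M < prod_mset (balanced_partition r n)"
proof -
  let ?T = "partitions (insert 1 {r..}) n"
  have fin: "finite (prod_mset ` ?T)"
    using assms(1) by (intro finite_imageI finite_partitions) auto
  have "Max (prod_mset ` ?T) \<in> prod_mset ` ?T"
    using assms(3) by (intro Max_in fin) auto
  then obtain C where C: "C \<in> ?T" "prod_mset C = Max (prod_mset ` ?T)"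
    by (metis imageE)
  have max: "prod_mset M \<le> prod_mset C" if "M \<in> ?T" for M
    using that fin C by simp
  have "C = balanced_partition r n"
    using improve_partition[OF assms(1,2) C(1)] max by (meson not_le)
  moreover obtain M' where "M' \<in> ?T" "prod_mset M < prod_mset M'"
    using improve_partition[OF assms] by blast
  ultimately show ?thesis
    using max by fastforce
qed

section \<open>Growth of the weights and dominance of one partition\<close>

text \<open>Up to the factorials of the multiplicities, the leading term of
  \<open>colourings w M\<close> for large weights.\<close>

definition monomial :: "(nat \<Rightarrow> nat) \<Rightarrow> nat multiset \<Rightarrow> nat" where
  "monomial w M = prod_mset (image_mset w M)"

lemma monomial_add [simp]: "monomial w (M + N) = monomial w M * monomial w N"
  by (simp add: monomial_def)

lemma monomial_pos:
  assumes "\<forall>k\<ge>1. w k \<ge> 1" "0 \<notin># M"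
  shows "monomial w M > 0"
proof -
  have "w k \<noteq> 0" if "k \<in># M" for k
    using assms that by (cases k) (auto simp: Suc_le_eq)
  then show ?thesis
    unfolding monomial_def by (metis gr0I prod_mset_zero_iff imageE set_image_mset)
qed

lemma colourings_le_monomial:
  assumes "\<forall>k\<ge>1. w k \<ge> 1" "0 \<notin># M"
  shows "colourings w M \<le> monomial w M"
proof -
  have "colourings w M \<le> (\<Prod>k\<in>set_mset M. w k ^ count M k)"
    unfolding colourings_def
  proof (intro prod_mono conjI multichoose_le_power)
    fix k assume "k \<in># M"
    then show "w k \<ge> 1"
      using assms by (cases k) auto
  qed simp
  then show ?thesis
    by (simp add: monomial_def image_prod_mset_multiplicity)
qed

text \<open>With P < Q the two products of parts, the ratio is at most P^\<Psi> / Q^\<Phi> <= P^B *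
  (P/Q)^\<Phi>. The bounded gap between the exponents leaves a constant factor, and \<Phi> tends to
  infinity.\<close>

lemma monomial_ratio_tendsto_0:
  assumes f: "admissible_weights f"
    and M: "0 \<notin># M" and N: "0 \<notin># N" and less: "prod_mset M < prod_mset N"
  shows "(\<lambda>l. real (monomial (f l) M) / real (monomial (f l) N)) \<longlonglongrightarrow> 0"
proof -
  obtain \<Phi> \<Psi> :: "nat \<Rightarrow> real" and B where
    bounds: "\<forall>l\<ge>1. \<forall>n\<ge>1. real n powr \<Phi> l \<le> real (f l n) \<and> real (f l n) \<le> real n powr \<Psi> l"
    and B: "\<forall>l\<ge>1. 0 \<le> \<Psi> l - \<Phi> l \<and> \<Psi> l - \<Phi> l \<le> B"
    and lim: "filterlim \<Phi> at_top sequentially"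
    using f unfolding admissible_weights_def by (elim conjE exE) (rule that)
  define P Q where "P = real (prod_mset M)" and "Q = real (prod_mset N)"
  have "prod_mset M \<ge> 1"
    using M by (metis One_nat_def Suc_leI gr0I prod_mset_zero_iff)
  then have P: "P \<ge> 1" "P < Q"
    using less unfolding P_def Q_def by simp_all
  have upper: "real (monomial (f l) M) \<le> real (prod_mset M) powr \<Psi> l" if "l \<ge> 1" "0 \<notin># M" for l M
    using that(2)
  proof (induction M)
    case (add k M)
    then have "real (f l k) \<le> real k powr \<Psi> l" "real (monomial (f l) M) \<le> real (prod_mset M) powr \<Psi> l"
      using bounds that(1) by (auto simp: Suc_le_eq)
    then have "real (f l k) * real (monomial (f l) M) \<le> real k powr \<Psi> l * real (prod_mset M) powr \<Psi> l"
      by (intro mult_mono) auto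
    then show ?case
      by (simp add: monomial_def powr_mult)
  qed (simp add: monomial_def)
  have lower: "real (prod_mset M) powr \<Phi> l \<le> real (monomial (f l) M)" if "l \<ge> 1" "0 \<notin># M" for l M
    using that(2)
  proof (induction M)
    case (add k M)
    then have "real k powr \<Phi> l \<le> real (f l k)" "real (prod_mset M) powr \<Phi> l \<le> real (monomial (f l) M)"
      using bounds that(1) by (auto simp: Suc_le_eq)
    then have "real k powr \<Phi> l * real (prod_mset M) powr \<Phi> l \<le> real (f l k) * real (monomial (f l) M)"
      by (intro mult_mono) auto
    then show ?case
      by (simp add: monomial_def powr_mult)
  qed (simp add: monomial_def)
  have le: "real (monomial (f l) M) / real (monomial (f l) N) \<le> P powr B * exp (ln (P / Q) * \<Phi> l)"
    if "l \<ge> 1" for l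
  proof -
    have "real (monomial (f l) M) / real (monomial (f l) N) \<le> P powr \<Psi> l / Q powr \<Phi> l"
      using upper[OF that M] lower[OF that N] P N by (intro frac_le) (auto simp: P_def Q_def)
    \<comment> \<open>Monotonicity in the exponent uses P >= 1.\<close>
    also have "\<dots> \<le> P powr (B + \<Phi> l) / Q powr \<Phi> l"
      using B that P by (intro divide_right_mono powr_mono) (auto simp: algebra_simps)
    also have "\<dots> = P powr B * (P / Q) powr \<Phi> l"
      using P by (simp add: powr_add powr_divide)
    also have "\<dots> = P powr B * exp (ln (P / Q) * \<Phi> l)"
      using P by (simp add: powr_def mult.commute)
    finally show ?thesis .
  qed
  have "ln (P / Q) < 0"
    using P by (simp add: ln_less_zero)
  then have "filterlim (\<lambda>l. ln (P / Q) * \<Phi> l) at_bot sequentially"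
    by (intro filterlim_tendsto_neg_mult_at_bot[OF tendsto_const _ lim])
  then have "(\<lambda>l. P powr B * exp (ln (P / Q) * \<Phi> l)) \<longlonglongrightarrow> P powr B * 0"
    by (intro tendsto_mult tendsto_const filterlim_compose[OF exp_at_bot])
  then have upper_lim: "(\<lambda>l. P powr B * exp (ln (P / Q) * \<Phi> l)) \<longlonglongrightarrow> 0"
    by simp
  show ?thesis
  proof (rule tendsto_sandwich[OF _ _ tendsto_const upper_lim])
    show "\<forall>\<^sub>F l in sequentially. real (monomial (f l) M) / real (monomial (f l) N)
        \<le> P powr B * exp (ln (P / Q) * \<Phi> l)"
      using eventually_ge_at_top[of 1] by eventually_elim (rule le)
  qed simp
qed

text \<open>The lower bound k^\<Phi> diverges for k >= 2; at k = 1 the weight stays 1.\<close>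

lemma admissible_weights_at_top:
  assumes f: "admissible_weights f" and "k \<ge> 2"
  shows "filterlim (\<lambda>l. f l k) at_top sequentially"
proof -
  obtain \<Phi> \<Psi> :: "nat \<Rightarrow> real" where
    bounds: "\<forall>l\<ge>1. \<forall>n\<ge>1. real n powr \<Phi> l \<le> real (f l n) \<and> real (f l n) \<le> real n powr \<Psi> l"
    and lim: "filterlim \<Phi> at_top sequentially"
    using f unfolding admissible_weights_def by (elim conjE exE) (rule that)
  have "ln (real k) > 0"
    using assms(2) by simp
  then have "filterlim (\<lambda>l. ln (real k) * \<Phi> l) at_top sequentially"
    by (intro filterlim_tendsto_pos_mult_at_top[OF tendsto_const _ lim])
  then have "filterlim (\<lambda>l. exp (ln (real k) * \<Phi> l)) at_top sequentially"
    by (rule filterlim_compose[OF exp_at_top])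
  moreover have "\<forall>\<^sub>F l in sequentially. exp (ln (real k) * \<Phi> l) \<le> real (f l k)"
    using eventually_ge_at_top[of 1]
  proof eventually_elim
    case (elim l)
    then show ?case
      using bounds elim assms(2) by (simp add: powr_def mult.commute)
  qed
  ultimately have "filterlim (\<lambda>l. real (f l k)) at_top sequentially"
    by (rule filterlim_at_top_mono)
  then show ?thesis
    by (simp add: filterlim_sequentially_iff_filterlim_real)
qed

lemma two_part_colourings_ratio_tendsto:
  fixes i j s t :: nat
  assumes f: "admissible_weights f" and "s \<noteq> t" "s \<ge> 2" "t \<ge> 2"
  defines "C \<equiv> replicate_mset i s + replicate_mset j t"
  shows "(\<lambda>l. real (colourings (f l) C) / real (monomial (f l) C)) \<longlonglongrightarrow> 1 / (fact i * fact j)"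
proof -
  have "(\<lambda>l. real ((f l s + i - 1) choose i) / real (f l s) ^ i *
      (real ((f l t + j - 1) choose j) / real (f l t) ^ j)) \<longlonglongrightarrow> 1 / fact i * (1 / fact j)"
    by (intro tendsto_mult multichoose_over_power_tendsto admissible_weights_at_top[OF f] assms)
  moreover have "colourings w C = ((w s + i - 1) choose i) * ((w t + j - 1) choose j)" for w
    using assms(2) by (subst colourings_superset[of "{s, t}"]) (auto simp: C_def)
  ultimately show ?thesis
    by (simp add: C_def monomial_def)
qed

text \<open>After division by the monomial of the unique maximiser C, each of the finitely many
  other terms tends to 0.\<close>

lemma p_coeff_ratio_tendsto:
  assumes f: "admissible_weights f" and S: "0 \<notin> S"
    and C: "C \<in> partitions S n"
    and max: "\<And>M. M \<in> partitions S n \<Longrightarrow> M \<noteq> C \<Longrightarrow> prod_mset M < prod_mset C"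
    and lim: "(\<lambda>l. real (colourings (f l) C) / real (monomial (f l) C)) \<longlonglongrightarrow> c"
  shows "(\<lambda>l. p_coeff ({1..} - S) (f l) n / real (monomial (f l) C)) \<longlonglongrightarrow> c"
proof -
  have nz: "0 \<notin># M" if "M \<in> partitions S n" for M
    using that S by (auto simp: partitions_def)
  have "{1..} - ({1..} - S) = S"
    using S by (auto simp: Suc_le_eq intro!: gr0I)
  then have eq: "p_coeff ({1..} - S) (f l) n / real (monomial (f l) C) =
      (\<Sum>M\<in>partitions S n. real (colourings (f l) M) / real (monomial (f l) C))" for l
    by (simp add: p_coeff_eq_sum_partitions sum_divide_distrib)
  have "(\<lambda>l. \<Sum>M\<in>partitions S n. real (colourings (f l) M) / real (monomial (f l) C))
      \<longlonglongrightarrow> (\<Sum>M\<in>partitions S n. if M = C then c else 0)"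
  proof (rule tendsto_sum)
    fix M assume M: "M \<in> partitions S n"
    show "(\<lambda>l. real (colourings (f l) M) / real (monomial (f l) C)) \<longlonglongrightarrow> (if M = C then c else 0)"
    proof (cases "M = C")
      case False
      have upper_lim: "(\<lambda>l. real (monomial (f l) M) / real (monomial (f l) C)) \<longlonglongrightarrow> 0"
        using M C False by (intro monomial_ratio_tendsto_0[OF f] nz max)
      have le: "\<forall>\<^sub>F l in sequentially. real (colourings (f l) M) / real (monomial (f l) C)
          \<le> real (monomial (f l) M) / real (monomial (f l) C)"
        using eventually_ge_at_top[of 1]
      proof eventually_elim
        case (elim l)
        then show ?case
          using f nz[OF M] colourings_le_monomial[of "f l" M]
          by (intro divide_right_mono) (auto simp: admissible_weights_def)
      qed
      have "(\<lambda>l. real (colourings (f l) M) / real (monomial (f l) C)) \<longlonglongrightarrow> 0"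
        by (rule tendsto_sandwich[OF _ le tendsto_const upper_lim]) simp
      then show ?thesis
        using False by simp
    qed (use lim in simp)
  qed
  then show ?thesis
    unfolding eq using C finite_partitions[OF S] by simp
qed

section \<open>From leading terms to the sign of a difference\<close>

text \<open>The right side is (i + 1) / i times the left side.\<close>

lemma fact_log_convex:
  assumes "i \<ge> 1"
  shows "fact i * fact i < (fact (i - 1) * fact (i + 1) :: real)"
proof -
  obtain j where "i = Suc j"
    using assms by (cases i) auto
  then show ?thesis
    by (simp add: algebra_simps add_pos_nonneg)
qed

text \<open>P, Q, R are the leading terms of p, q, s. Divided by P^2, the difference p^2 - q * s
  tends to a^2 - b * c * \<rho>, which is positive.\<close>

lemma eventually_product_less_square:
  fixes p q s P Q R :: "nat \<Rightarrow> real"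
  assumes "(\<lambda>l. p l / P l) \<longlonglongrightarrow> a" "(\<lambda>l. q l / Q l) \<longlonglongrightarrow> b" "(\<lambda>l. s l / R l) \<longlonglongrightarrow> c"
    and pos: "\<forall>\<^sub>F l in sequentially. P l > 0 \<and> Q l > 0 \<and> R l > 0"
    and \<rho>: "(\<lambda>l. Q l * R l / (P l * P l)) \<longlonglongrightarrow> \<rho>"
    and less: "b * c * \<rho> < a\<^sup>2"
  shows "\<forall>\<^sub>F l in sequentially. q l * s l < (p l)\<^sup>2"
proof -
  have "(\<lambda>l. (p l / P l)\<^sup>2 - (q l / Q l) * (s l / R l) * (Q l * R l / (P l * P l)))
      \<longlonglongrightarrow> a\<^sup>2 - b * c * \<rho>"
    by (intro tendsto_diff tendsto_mult tendsto_power assms)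
  then have "\<forall>\<^sub>F l in sequentially.
      0 < (p l / P l)\<^sup>2 - (q l / Q l) * (s l / R l) * (Q l * R l / (P l * P l))"
    by (rule order_tendstoD) (use less in simp)
  with pos show ?thesis
  proof eventually_elim
    case (elim l)
    have "(p l / P l)\<^sup>2 - (q l / Q l) * (s l / R l) * (Q l * R l / (P l * P l))
        = ((p l)\<^sup>2 - q l * s l) / (P l)\<^sup>2"
      using elim by (simp add: power2_eq_square diff_divide_distrib)
    then show ?case
      using elim by (simp add: zero_less_divide_iff)
  qed
qed

text \<open>Here P^2 is negligible against Q * R, so the difference is normalised by Q * R; its
  limit is -(b * c).\<close>

lemma eventually_square_less_product:
  fixes p q s P Q R :: "nat \<Rightarrow> real"
  assumes "(\<lambda>l. p l / P l) \<longlonglongrightarrow> a" "(\<lambda>l. q l / Q l) \<longlonglongrightarrow> b" "(\<lambda>l. s l / R l) \<longlonglongrightarrow> c"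
    and pos: "\<forall>\<^sub>F l in sequentially. P l > 0 \<and> Q l > 0 \<and> R l > 0"
    and \<rho>: "(\<lambda>l. P l * P l / (Q l * R l)) \<longlonglongrightarrow> 0"
    and bc: "b * c > 0"
  shows "\<forall>\<^sub>F l in sequentially. (p l)\<^sup>2 < q l * s l"
proof -
  have "(\<lambda>l. (p l / P l)\<^sup>2 * (P l * P l / (Q l * R l)) - (q l / Q l) * (s l / R l))
      \<longlonglongrightarrow> a\<^sup>2 * 0 - b * c"
    by (intro tendsto_diff tendsto_mult tendsto_power assms)
  then have "\<forall>\<^sub>F l in sequentially.
      (p l / P l)\<^sup>2 * (P l * P l / (Q l * R l)) - (q l / Q l) * (s l / R l) < 0"
    by (rule order_tendstoD) (use bc in simp)
  with pos show ?thesis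
  proof eventually_elim
    case (elim l)
    have eq: "(p l / P l)\<^sup>2 * (P l * P l / (Q l * R l)) - (q l / Q l) * (s l / R l)
        = ((p l)\<^sup>2 - q l * s l) / (Q l * R l)"
      using elim by (simp add: power2_eq_square diff_divide_distrib)
    have "Q l * R l > 0"
      using elim by simp
    moreover have "((p l)\<^sup>2 - q l * s l) / (Q l * R l) < 0"
      using elim(2) unfolding eq .
    ultimately have "(p l)\<^sup>2 - q l * s l < 0"
      by (metis divide_less_0_iff less_asym)
    then show ?case
      by simp
  qed
qed

section \<open>Balanced partitions of n - 1, n and n + 1\<close>

text \<open>With d = a - r, both sides share the factor r^(2 * d + r - 1); what remains is (r + 1)^r
  < r^(r + 1).\<close>

lemma balanced_partition_products_mod_0:
  assumes r: "r \<ge> 3" and "r < a"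
  defines "C \<equiv> balanced_partition r"
  shows "prod_mset (C (a * r - 1) + C (a * r + 1)) < prod_mset (C (a * r) + C (a * r))"
proof -
  obtain d where d: "a = r + d"
    using assms(2) le_Suc_ex less_imp_le by blast
  \<comment> \<open>Below a multiple of r the quotient drops by one and the remainder jumps to r -
    1.\<close>
  have "a * r - 1 = (a - 1) * r + (r - 1)"
    using assms by (cases a) auto
  then have "C (a * r - 1) = replicate_mset d r + replicate_mset (r - 1) (r + 1)"
    "C (a * r + 1) = replicate_mset (d + (r - 1)) r + replicate_mset 1 (r + 1)"
    "C (a * r) = replicate_mset (d + r) r"
    using balanced_partition_eq[of "r - 1" r "a - 1"] balanced_partition_eq[of 1 r a]
      balanced_partition_eq[of 0 r a] r
    by (simp_all add: C_def d add.commute)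
  then have prod_l: "prod_mset (C (a * r - 1) + C (a * r + 1))
      = r ^ d * (r + 1) ^ (r - 1) * (r ^ (d + (r - 1)) * (r + 1) ^ 1)"
    and prod_r: "prod_mset (C (a * r) + C (a * r)) = r ^ (d + r) * r ^ (d + r)"
    by (simp_all only: prod_mset_Un prod_mset_replicate_mset)
  note prod_l
  also have "r ^ d * (r + 1) ^ (r - 1) * (r ^ (d + (r - 1)) * (r + 1) ^ 1)
      = r ^ (d + (d + (r - 1))) * (r + 1) ^ (r - 1 + 1)"
    by (simp only: power_add mult_ac)
  also have "r - 1 + 1 = r"
    using r by simp
  also have "r ^ (d + (d + (r - 1))) * (r + 1) ^ r < r ^ (d + (d + (r - 1))) * r ^ (r + 1)"
    using power_swap_less[OF r, of "r + 1"] r by simp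
  also have "\<dots> = prod_mset (C (a * r) + C (a * r))"
    unfolding prod_r power_add[symmetric]
    using r by (intro arg_cong[where f = "\<lambda>k. r ^ k"]) simp
  finally show ?thesis .
qed

text \<open>With e = a - (r - 1), both sides share r^(2 * e) * (r + 1)^(r - 2); the same inequality
  (r + 1)^r < r^(r + 1) remains, now in favour of the neighbours.\<close>

lemma balanced_partition_products_mod_last:
  assumes r: "r \<ge> 3" and "r \<le> a" and n: "n = a * r + (r - 1)"
  defines "C \<equiv> balanced_partition r"
  shows "prod_mset (C n + C n) < prod_mset (C (n - 1) + C (n + 1))"
proof -
  obtain e where e: "a = (r - 1) + e"
    using assms(2) le_Suc_ex[of "r - 1" a] diff_le_self le_trans by blast
  have "n - 1 = a * r + (r - 2)" "n + 1 = (a + 1) * r"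
    using n r by auto
  then have "C (n - 1) = replicate_mset (e + 1) r + replicate_mset (r - 2) (r + 1)"
    "C n = replicate_mset e r + replicate_mset (r - 1) (r + 1)"
    "C (n + 1) = replicate_mset (e + r) r"
    using balanced_partition_eq[of "r - 2" r a] balanced_partition_eq[of "r - 1" r a]
      balanced_partition_eq[of 0 r "a + 1"] n r
    by (simp_all add: C_def e add.commute)
  then have prod_l: "prod_mset (C n + C n)
      = r ^ e * (r + 1) ^ (r - 1) * (r ^ e * (r + 1) ^ (r - 1))"
    and prod_r: "prod_mset (C (n - 1) + C (n + 1))
      = r ^ (e + 1) * (r + 1) ^ (r - 2) * r ^ (e + r)"
    by (simp_all only: prod_mset_Un prod_mset_replicate_mset)
  have exps: "r - 1 + (r - 1) = r - 2 + r"
    using r by simp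
  have "prod_mset (C n + C n) = r ^ (e + e) * (r + 1) ^ (r - 1 + (r - 1))"
    unfolding prod_l by (simp only: power_add mult_ac)
  also have "\<dots> = r ^ (e + e) * (r + 1) ^ (r - 2) * (r + 1) ^ r"
    unfolding exps by (simp only: power_add mult_ac)
  also have "\<dots> < r ^ (e + e) * (r + 1) ^ (r - 2) * r ^ (r + 1)"
    using power_swap_less[OF r, of "r + 1"] r by simp
  also have "\<dots> = prod_mset (C (n - 1) + C (n + 1))"
    unfolding prod_r by (simp only: power_add mult_ac)
  finally show ?thesis .
qed

text \<open>The limit of \<open>colourings\<close> over \<open>monomial\<close> at
  \<open>balanced_partition r n\<close>, hence of the coefficient over its leading monomial.\<close>

definition balanced_coeff :: "nat \<Rightarrow> nat \<Rightarrow> real" where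
  "balanced_coeff r n = 1 / (fact (n div r - n mod r) * fact (n mod r))"

lemma balanced_coeff_pos: "balanced_coeff r n > 0"
  by (simp add: balanced_coeff_def)

lemma balanced_coeff_eq:
  assumes "b < r"
  shows "balanced_coeff r (a * r + b) = 1 / (fact (a - b) * fact b)"
  using assms by (simp add: balanced_coeff_def)

text \<open>The quotient is a at all three arguments, so each step by one turns a part r into r + 1
  and the outer multiplicities average to the middle ones. Log-convexity of the factorial is applied
  to both multiplicities.\<close>

lemma balanced_partition_mod_middle:
  assumes "b \<noteq> 0" "b < r - 1" "b < a" and n: "n = a * r + b"
  shows "balanced_partition r (n - 1) + balanced_partition r (n + 1)
      = balanced_partition r n + balanced_partition r n"
    and "balanced_coeff r (n - 1) * balanced_coeff r (n + 1) < (balanced_coeff r n)\<^sup>2"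
proof -
  \<comment> \<open>i is the multiplicity of r at n + 1, and j that of r + 1 at n - 1.\<close>
  obtain i j where ij: "b = Suc j" "a = b + Suc i"
    using assms(1,3) by (metis less_imp_Suc_add add_Suc_right not0_implies_Suc)
  have n': "n - 1 = a * r + j" "n + 1 = a * r + (j + 2)" "n = a * r + (j + 1)"
    using n ij by auto
  have j: "j < r" "j + 1 < r" "j + 2 < r"
    using assms(2) ij by auto
  have diffs: "a - j = i + 2" "a - (j + 1) = i + 1" "a - (j + 2) = i"
    using ij by auto
  have "balanced_partition r (n - 1) = replicate_mset (i + 2) r + replicate_mset j (r + 1)"
    "balanced_partition r (n + 1) = replicate_mset i r + replicate_mset (j + 2) (r + 1)"
    "balanced_partition r n = replicate_mset (i + 1) r + replicate_mset (j + 1) (r + 1)"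
    using balanced_partition_eq[OF j(1), of a, folded n'(1)]
      balanced_partition_eq[OF j(2), of a, folded n'(3)]
      balanced_partition_eq[OF j(3), of a, folded n'(2)] by (simp_all only: diffs)
  then show "balanced_partition r (n - 1) + balanced_partition r (n + 1)
      = balanced_partition r n + balanced_partition r n"
    by (simp add: numeral_2_eq_2)
  have c: "balanced_coeff r (n - 1) = 1 / (fact (i + 1 + 1) * fact (j + 1 - 1))"
    "balanced_coeff r (n + 1) = 1 / (fact (i + 1 - 1) * fact (j + 1 + 1))"
    "balanced_coeff r n = 1 / (fact (i + 1) * fact (j + 1))"
    using balanced_coeff_eq[OF j(1), of a, folded n'(1)]
      balanced_coeff_eq[OF j(2), of a, folded n'(3)]
      balanced_coeff_eq[OF j(3), of a, folded n'(2)] diffs by (simp_all del: fact_Suc)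
  have "(fact (i + 1) * fact (i + 1)) * (fact (j + 1) * fact (j + 1)) <
      (fact (i + 1 - 1) * fact (i + 1 + 1)) * (fact (j + 1 - 1) * fact (j + 1 + 1) :: real)"
    by (intro mult_strict_mono fact_log_convex) (auto simp del: fact_Suc)
  then show "balanced_coeff r (n - 1) * balanced_coeff r (n + 1) < (balanced_coeff r n)\<^sup>2"
    unfolding c power2_eq_square by (simp add: frac_less2 mult_ac del: fact_Suc)
qed

section \<open>Asymptotics of the coefficients and the sign of \<open>Delta\<close>\<close>

text \<open>Maximality over all parts in \<open>insert 1 {r..}\<close> passes to S, since S still
  contains both parts of the balanced partition.\<close>

lemma p_coeff_balanced_ratio_tendsto:
  assumes f: "admissible_weights f" and r: "r \<ge> 3" and n: "2 * n > 3 * r * (r - 1) * (r - 1)"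
    and S: "S \<subseteq> insert 1 {r..}" "r \<in> S" "r + 1 \<in> S"
  shows "(\<lambda>l. p_coeff ({1..} - S) (f l) n / real (monomial (f l) (balanced_partition r n)))
      \<longlonglongrightarrow> balanced_coeff r n"
proof (rule p_coeff_ratio_tendsto[OF f])
  show "0 \<notin> S"
    using S r by auto
  show "balanced_partition r n \<in> partitions S n"
    using balanced_partition_in_partitions(2)[OF r n S(2,3)] .
  show "prod_mset M < prod_mset (balanced_partition r n)"
    if "M \<in> partitions S n" "M \<noteq> balanced_partition r n" for M
    using that S(1) balanced_partition_maximal[OF r n, of M] by (auto simp: partitions_def)
  show "(\<lambda>l. real (colourings (f l) (balanced_partition r n)) /
      real (monomial (f l) (balanced_partition r n))) \<longlonglongrightarrow> balanced_coeff r n"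
    unfolding balanced_partition_def balanced_coeff_def
    by (rule two_part_colourings_ratio_tendsto[OF f]) (use r in auto)
qed

theorem theorem2p6:
  fixes f :: "nat \<Rightarrow> nat \<Rightarrow> nat" and S E :: "nat set" and r n :: nat
  assumes "admissible_weights f"
    and "S \<subseteq> {1..}" and "E = {1..} - S"
    and "r \<ge> 3"
    and "1 \<in> S" and "r \<in> S" and "r + 1 \<in> S" and "{2..r - 1} \<subseteq> E"
    and "real n \<ge> (real r * (real r - 1) * (3 * real r - 1) + 4) / 2"
  shows "(\<not> [n = r - 1] (mod r) \<longrightarrow> (\<forall>\<^sub>\<infinity>l. Delta E (f l) n > 0)) \<and>
         ([n = r - 1] (mod r) \<longrightarrow> (\<forall>\<^sub>\<infinity>l. Delta E (f l) n < 0))"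
proof -
  define a b where "a = n div r" and "b = n mod r"
  define C where "C = balanced_partition r"
  define F where "F m l = real (monomial (f l) (C m))" for m l
  define c where "c = balanced_coeff r"
  have S: "S \<subseteq> insert 1 {r..}"
  proof
    fix k assume "k \<in> S"
    then have "k \<ge> 1" "k \<notin> {2..r - 1}"
      using assms(2,3,8) by auto
    then show "k \<in> insert 1 {r..}"
      by auto
  qed
  \<comment> \<open>The asymptotics are required at n - 1, n and n + 1. The summand 4 in the
    hypothesis absorbs the 2 lost on passing from 2 * n to 2 * (n - 1).\<close>
  have large: "2 * (n - 1) > 3 * r * (r - 1) * (r - 1)"
  proof -
    have "3 * real r * (real r - 1) * (real r - 1) \<le> real r * (real r - 1) * (3 * real r - 1)"
      using assms(4) by (simp add: algebra_simps)
    then have "3 * real r * (real r - 1) * (real r - 1) + 2 < 2 * real n"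
      using assms(9) by argo
    then have "real (3 * r * (r - 1) * (r - 1) + 2) < real (2 * n)"
      using assms(4) by (simp add: of_nat_diff)
    then show ?thesis
      by linarith
  qed
  then have m: "2 * m > 3 * r * (r - 1) * (r - 1)" if "m \<ge> n - 1" for m
    using that by linarith
  have asymp: "(\<lambda>l. p_coeff E (f l) m / F m l) \<longlonglongrightarrow> c m" if "m \<ge> n - 1" for m
    unfolding F_def C_def c_def assms(3)
    by (rule p_coeff_balanced_ratio_tendsto[OF assms(1,4) m[OF that] S assms(6,7)])
  have C0: "0 \<notin># C m" for m
    using assms(4) by (auto simp: C_def balanced_partition_def split: if_splits)
  have F_pos: "\<forall>\<^sub>F l in sequentially. F m l > 0" for m
    using eventually_ge_at_top[of 1]
  proof eventually_elim
    case (elim l)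
    then show ?case
      using assms(1) C0 monomial_pos[of "f l"] by (simp add: F_def admissible_weights_def)
  qed
  have F_pos': "\<forall>\<^sub>F l in sequentially. F n l > 0 \<and> F (n - 1) l > 0 \<and> F (n + 1) l > 0"
    by (intro eventually_conj F_pos)
  have ab: "n = a * r + b" "b < r"
    using assms(4) by (simp_all add: a_def b_def)
  have "(n - 1) mod r < (n - 1) div r" "b < a"
    using balanced_partition_in_partitions(1)[OF assms(4) m assms(6,7)]
    by (auto simp: a_def b_def)
  have ratio: "(\<lambda>l. F i l * F j l / (F k l * F m l)) \<longlonglongrightarrow> 0"
    if "prod_mset (C i + C j) < prod_mset (C k + C m)" for i j k m
    using monomial_ratio_tendsto_0[OF assms(1) _ _ that] C0 by (simp add: F_def)
  have pos: "\<forall>\<^sub>F l in sequentially. Delta E (f l) n > 0"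
    if "(\<lambda>l. F (n - 1) l * F (n + 1) l / (F n l * F n l)) \<longlonglongrightarrow> \<rho>"
      and "c (n - 1) * c (n + 1) * \<rho> < (c n)\<^sup>2" for \<rho>
    using eventually_product_less_square[OF asymp asymp asymp F_pos' that] by (simp add: Delta_def)
  have neg: "\<forall>\<^sub>F l in sequentially. Delta E (f l) n < 0"
    if "(\<lambda>l. F n l * F n l / (F (n - 1) l * F (n + 1) l)) \<longlonglongrightarrow> 0"
      and "c (n - 1) * c (n + 1) > 0"
    using eventually_square_less_product[OF asymp asymp asymp F_pos' that] by (simp add: Delta_def)
  consider (zero) "b = 0" | (middle) "b \<noteq> 0" "b < r - 1" | (last) "b = r - 1"
    using ab(2) by linarith
  then show ?thesis
  proof cases
    case zero
    \<comment> \<open>At n - 1 the remainder r - 1 is below the quotient a - 1, which yields a >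
      r.\<close>
    have "n - 1 = (a - 1) * r + (r - 1)"
      using ab zero \<open>b < a\<close> assms(4) by (cases a) auto
    then have "(n - 1) div r = a - 1" "(n - 1) mod r = r - 1"
      using assms(4) by (simp_all only: div_mult_self3 mod_mult_self3) auto
    then have "a > r"
      using \<open>(n - 1) mod r < (n - 1) div r\<close> by simp
    then have "prod_mset (C (n - 1) + C (n + 1)) < prod_mset (C n + C n)"
      using balanced_partition_products_mod_0[OF assms(4), of a] ab zero by (simp add: C_def)
    \<comment> \<open>The neighbours' monomials are negligible against the square, so the limiting
      ratio is 0.\<close>
    moreover have "c (n - 1) * c (n + 1) * 0 < (c n)\<^sup>2"
      using balanced_coeff_pos[of r n] by (simp add: c_def)
    ultimately have "\<forall>\<^sub>F l in sequentially. Delta E (f l) n > 0"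
      by (intro pos[OF ratio])
    moreover have "\<not> [n = r - 1] (mod r)"
      using zero assms(4) by (simp add: cong_def b_def)
    ultimately show ?thesis
      by (simp add: cofinite_eq_sequentially)
  next
    case middle
    note mid = balanced_partition_mod_middle[OF middle \<open>b < a\<close> ab(1)]
    \<comment> \<open>Equal monomials give the limiting ratio 1, so the coefficients decide.\<close>
    have "F (n - 1) l * F (n + 1) l = F n l * F n l" for l
      using arg_cong[OF mid(1), of "monomial (f l)"] unfolding F_def C_def
      by (metis monomial_add of_nat_mult)
    then have "\<forall>\<^sub>F l in sequentially. F (n - 1) l * F (n + 1) l / (F n l * F n l) = 1"
      using F_pos[of n] by (auto elim: eventually_mono)
    moreover have "c (n - 1) * c (n + 1) * 1 < (c n)\<^sup>2"
      using mid(2) by (simp add: c_def)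
    ultimately have "\<forall>\<^sub>F l in sequentially. Delta E (f l) n > 0"
      by (intro pos[OF tendsto_eventually])
    moreover have "\<not> [n = r - 1] (mod r)"
      using middle assms(4) by (simp add: cong_def b_def)
    ultimately show ?thesis
      by (simp add: cofinite_eq_sequentially)
  next
    case last
    \<comment> \<open>Now n + 1 is a multiple of r, and the square is the negligible side.\<close>
    then have "prod_mset (C n + C n) < prod_mset (C (n - 1) + C (n + 1))"
      using balanced_partition_products_mod_last[OF assms(4), of a n] ab \<open>b < a\<close> by (simp add: C_def)
    moreover have "c (n - 1) * c (n + 1) > 0"
      unfolding c_def by (intro mult_pos_pos balanced_coeff_pos)
    ultimately have "\<forall>\<^sub>F l in sequentially. Delta E (f l) n < 0"
      by (intro neg[OF ratio])
    moreover have "[n = r - 1] (mod r)"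
      using last assms(4) by (simp add: cong_def b_def)
    ultimately show ?thesis
      by (simp add: cofinite_eq_sequentially)
  qed
qed

end
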